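(* Let $I$ be an interval in $\mathbb{R}$. Then $L^1_G(I)$ is a proper subset of $L^1_H(I)$, i.e. $L^1_G(I) \subseteq L^1_H(I)$ and $L^1_G(I) \neq L^1_H(I)$.
   Context: $\mu$ denotes Lebesgue measure on $\mathbb{R}$. For an interval $I$ in $\mathbb{R}$: $L^1_G(I)$ is the space of measurable functions $f : I \to \mathbb{R}$ such that $\int_K |f| \, d\mu < \infty$ for every Lebesgue measurable set $K \subseteq I$ with $\mu(K) < \infty$. $L^1_H(I)$ is the set of all measurable functions $f : I \to \mathbb{R}$ for which there exists $M > 0$ (depending on $f$) such that $\mu(\{x \in I : |f(x)| \geq M\}) < \infty$. *)

theory Defs
  imports "HOL-Analysis.Analysis"
begin

(* A function I -> real is encoded as a total function that takes the value undefined outside I,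
   so that set-theoretic (in)equality of spaces only concerns the values on I. *)
definition lebesgue_measurable_funs :: "real set \<Rightarrow> (real \<Rightarrow> real) set" where
  "lebesgue_measurable_funs I = borel_measurable (lebesgue_on I) \<inter> extensional I"

definition L1_G :: "real set \<Rightarrow> (real \<Rightarrow> real) set" where
  "L1_G I = {f \<in> lebesgue_measurable_funs I.
     \<forall>K. K \<in> sets lebesgue \<longrightarrow> K \<subseteq> I \<longrightarrow> emeasure lebesgue K < \<infinity> \<longrightarrow>
       (\<integral>\<^sup>+x\<in>K. ennreal \<bar>f x\<bar> \<partial>lebesgue) < \<infinity>}"

definition L1_H :: "real set \<Rightarrow> (real \<Rightarrow> real) set" where
  "L1_H I = {f \<in> lebesgue_measurable_funs I.
     \<exists>M>0. emeasure lebesgue {x \<in> I. \<bar>f x\<bar> \<ge> M} < \<infinity>}"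

(* The interval must have more than one point: for an empty or one-point I both spaces consist of
   all functions on I and coincide. *)
definition nondegenerate_interval :: "real set \<Rightarrow> bool" where
  "nondegenerate_interval I \<longleftrightarrow> is_interval I \<and> (\<exists>a\<in>I. \<exists>b\<in>I. a < b)"

end

theory Submission
  imports Defs
begin

text \<open>
  A function \<open>f\<close> that is not in \<open>L1_H I\<close> has level sets \<open>{x \<in> I. \<bar>f x\<bar> \<ge> M}\<close> of infinite measure for
  every \<open>M > 0\<close>. Lebesgue measure has no atoms, so these level sets contain subsets of every
  prescribed measure (\<open>subset_of_given_measure\<close>). A subset of \<open>{\<bar>f\<bar> \<ge> 4^n}\<close> of measure \<open>2^-n\<close> carries
  at least the mass \<open>2^n\<close> of \<open>\<bar>f\<bar>\<close> (\<open>level_set_lower_bound\<close>). The union of these subsets over all \<open>n\<close>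
  has finite measure, but the integral of \<open>\<bar>f\<bar>\<close> over it is infinite. Hence \<open>f\<close> is not in \<open>L1_G I\<close>.

  The inclusion is strict because membership in \<open>L1_H I\<close> does not see local singularities: if
  \<open>a < b\<close> are points of \<open>I\<close>, the function equal to \<open>1 / (x - a)\<^sup>2\<close> on \<open>{a<..b}\<close> and to \<open>0\<close> on the rest
  of \<open>I\<close> is large only on a bounded set, but is not integrable over \<open>{a<..b}\<close>.
\<close>

text \<open>The measure of \<open>A \<inter> {-r..r}\<close> is a Lipschitz function of \<open>r \<ge> 0\<close> that vanishes at \<open>0\<close> and
  tends to the measure of \<open>A\<close>, so the intermediate value theorem applies to it.\<close>

lemma subset_of_given_measure:
  fixes A :: "real set" and c :: real
  assumes A: "A \<in> sets lebesgue" and inf: "emeasure lebesgue A = \<infinity>" and c: "c \<ge> 0"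
  obtains E where "E \<in> sets lebesgue" "E \<subseteq> A" "emeasure lebesgue E = ennreal c"
proof -
  define m where "m r = measure lebesgue (A \<inter> {-r..r})" for r :: real
  have meas: "A \<inter> {-r..r} \<in> lmeasurable" for r :: real
    using A by (subst Int_commute) (rule fmeasurable_Int_fmeasurable, simp)
  \<comment> \<open>Enlarging \<open>r\<close> to \<open>s\<close> adds at most the two intervals \<open>{-s..-r}\<close> and \<open>{r..s}\<close>.\<close>
  have lip: "m s \<le> m r + 2 * (s - r)" if "r \<le> s" "0 \<le> r" for r s
  proof -
    have "m s \<le> measure lebesgue ((A \<inter> {-r..r}) \<union> ({-s..-r} \<union> {r..s}))"
      unfolding m_def using that meas
      by (intro measure_mono_fmeasurable fmeasurable.Un) (auto simp: fmeasurableD)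
    also have "\<dots> \<le> m r + measure lebesgue ({-s..-r} \<union> {r..s})"
      unfolding m_def using meas by (intro measure_Un_le) (auto simp: fmeasurableD)
    also have "measure lebesgue ({-s..-r} \<union> {r..s}) \<le> measure lebesgue {-s..-r} + measure lebesgue {r..s}"
      by (intro measure_Un_le) auto
    finally show ?thesis using that by simp
  qed
  have mono: "m r \<le> m s" if "r \<le> s" for r s
    unfolding m_def using that meas by (intro measure_mono_fmeasurable) (auto simp: fmeasurableD)
  have "m 0 \<le> measure lebesgue {0::real}"
    unfolding m_def using meas[of 0]
    by (intro measure_mono_fmeasurable) (auto simp: fmeasurableD bounded_set_imp_lmeasurable)
  then have m0: "m 0 = 0"
    by (simp add: m_def measure_nonneg antisym)
  have lim: "(\<lambda>n. emeasure lebesgue (A \<inter> {- real n..real n})) \<longlonglongrightarrow> emeasure lebesgue (\<Union>n. A \<inter> {- real n..real n})"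
    using meas by (intro Lim_emeasure_incseq) (auto simp: incseq_def fmeasurableD)
  have "(\<Union>n. A \<inter> {- real n..real n}) = A"
  proof -
    have "\<exists>n. - real n \<le> x \<and> x \<le> real n" for x :: real
      using real_arch_simple[of "\<bar>x\<bar>"] by (metis abs_le_iff minus_le_iff)
    then show ?thesis by fastforce
  qed
  then have "\<forall>\<^sub>F n in sequentially. emeasure lebesgue (A \<inter> {- real n..real n}) > ennreal c"
    using lim inf by (intro order_tendstoD(1)) auto
  then obtain n where "emeasure lebesgue (A \<inter> {- real n..real n}) > ennreal c"
    by (auto simp: eventually_sequentially)
  then have n: "c \<le> m (real n)"
    using meas[of "real n"] c by (simp add: m_def emeasure_eq_measure2 ennreal_less_iff)
  have "2-lipschitz_on {0..real n} m"
  proof (rule lipschitz_onI)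
    fix r s assume rs: "r \<in> {0..real n}" "s \<in> {0..real n}"
    show "dist (m r) (m s) \<le> 2 * dist r s"
      using rs lip[of r s] mono[of r s] lip[of s r] mono[of s r]
      by (cases "r \<le> s") (auto simp: dist_real_def)
  qed simp
  then have "continuous_on {0..real n} m"
    by (rule lipschitz_on_continuous_on)
  then obtain r where "m r = c"
    using IVT'[of m 0 c "real n"] m0 c n by auto
  then have "emeasure lebesgue (A \<inter> {-r..r}) = ennreal c"
    using meas[of r] by (simp add: m_def emeasure_eq_measure2)
  with that[of "A \<inter> {-r..r}"] meas[of r] show thesis by (auto simp: fmeasurableD)
qed

lemma level_set_lower_bound:
  assumes "E \<in> sets M" "E \<subseteq> K" "\<And>x. x \<in> E \<Longrightarrow> c \<le> g x"
  shows "c * emeasure M E \<le> (\<integral>\<^sup>+x\<in>K. g x \<partial>M)"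
proof -
  have "c * emeasure M E = (\<integral>\<^sup>+x. c * indicator E x \<partial>M)"
    using assms(1) by (simp add: nn_integral_cmult_indicator)
  also have "\<dots> \<le> (\<integral>\<^sup>+x\<in>K. g x \<partial>M)"
    using assms by (intro nn_integral_mono) (auto simp: indicator_def)
  finally show ?thesis .
qed

lemma ennreal_eq_top_if_unbounded:
  assumes "\<And>n::nat. ennreal (real n) \<le> y"
  shows "y = \<infinity>"
proof (rule ccontr)
  assume "y \<noteq> \<infinity>"
  then obtain r where r: "y = ennreal r" "r \<ge> 0" by (cases y) auto
  obtain n where "r < real n" using reals_Archimedean2 by blast
  with assms[of n] r show False by (simp add: ennreal_le_iff)
qed

text \<open>The pieces of \<open>K\<close> have measure \<open>2^-n\<close>, so that their measures are summable, while the
  threshold \<open>4^n\<close> grows fast enough for a single piece to give the lower bound \<open>2^n\<close> for the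
  integral over all of \<open>K\<close>.\<close>

lemma infinite_level_sets_imp_infinite_integral:
  fixes g :: "real \<Rightarrow> real"
  assumes meas: "\<And>n::nat. {x \<in> I. g x \<ge> 4 ^ n} \<in> sets lebesgue"
    and inf: "\<And>n::nat. emeasure lebesgue {x \<in> I. g x \<ge> 4 ^ n} = \<infinity>"
  obtains K where "K \<in> sets lebesgue" "K \<subseteq> I" "emeasure lebesgue K < \<infinity>"
    "(\<integral>\<^sup>+x\<in>K. ennreal (g x) \<partial>lebesgue) = \<infinity>"
proof -
  have "\<exists>E. E \<in> sets lebesgue \<and> E \<subseteq> {x \<in> I. g x \<ge> 4 ^ n} \<and> emeasure lebesgue E = ennreal ((1/2) ^ n)"
    for n :: nat
    by (rule subset_of_given_measure[OF meas inf, of "(1/2) ^ n" n]) auto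
  then obtain E where E: "\<And>n. E n \<in> sets lebesgue" "\<And>n. E n \<subseteq> {x \<in> I. g x \<ge> 4 ^ n}"
    "\<And>n. emeasure lebesgue (E n) = ennreal ((1/2) ^ n)"
    by metis
  define K where "K = (\<Union>n. E n)"
  have "emeasure lebesgue K \<le> (\<Sum>n. emeasure lebesgue (E n))"
    unfolding K_def using E(1) by (intro emeasure_subadditive_countably) auto
  also have "\<dots> = (\<Sum>n. ennreal ((1/2) ^ n))"
    by (simp add: E(3))
  also have "\<dots> < \<infinity>"
    by (subst suminf_ennreal2) (auto intro: summable_geometric)
  finally have fin: "emeasure lebesgue K < \<infinity>" .
  have "ennreal (real n) \<le> (\<integral>\<^sup>+x\<in>K. ennreal (g x) \<partial>lebesgue)" for n
  proof -
    have "ennreal (real n) \<le> ennreal (2 ^ n)"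
      by (intro ennreal_leI) (simp add: less_imp_le of_nat_less_two_power)
    also have "(2::real) ^ n = 4 ^ n * (1/2) ^ n"
      by (simp flip: power_mult_distrib)
    also have "ennreal (4 ^ n * (1/2) ^ n) = ennreal (4 ^ n) * emeasure lebesgue (E n)"
      by (simp add: E(3) flip: ennreal_mult)
    also have "\<dots> \<le> (\<integral>\<^sup>+x\<in>K. ennreal (g x) \<partial>lebesgue)"
      using E(1) E(2)[of n] by (intro level_set_lower_bound) (auto simp: K_def intro!: ennreal_leI)
    finally show ?thesis .
  qed
  then have "(\<integral>\<^sup>+x\<in>K. ennreal (g x) \<partial>lebesgue) = \<infinity>"
    by (rule ennreal_eq_top_if_unbounded)
  moreover have "K \<in> sets lebesgue" "K \<subseteq> I"
    using E(1,2) by (auto simp: K_def)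
  ultimately show thesis using that fin by blast
qed

lemma L1_G_subset_L1_H:
  assumes I: "I \<in> sets lebesgue"
  shows "L1_G I \<subseteq> L1_H I"
proof
  fix f assume f: "f \<in> L1_G I"
  then have f_meas: "f \<in> lebesgue_measurable_funs I"
    by (simp add: L1_G_def)
  then have "f \<in> borel_measurable (lebesgue_on I)"
    by (simp add: lebesgue_measurable_funs_def)
  then have "{x \<in> space (lebesgue_on I). \<bar>f x\<bar> \<ge> c} \<in> sets (lebesgue_on I)" for c
    by measurable
  then have level: "{x \<in> I. \<bar>f x\<bar> \<ge> c} \<in> sets lebesgue" for c
    using I by (simp add: sets_restrict_space_iff)
  show "f \<in> L1_H I"
  proof (rule ccontr)
    assume "f \<notin> L1_H I"
    then have "emeasure lebesgue {x \<in> I. \<bar>f x\<bar> \<ge> 4 ^ n} = \<infinity>" for n :: nat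
      using f_meas by (auto simp: L1_H_def less_top[symmetric])
    with level obtain K where "K \<in> sets lebesgue" "K \<subseteq> I" "emeasure lebesgue K < \<infinity>"
      "(\<integral>\<^sup>+x\<in>K. ennreal \<bar>f x\<bar> \<partial>lebesgue) = \<infinity>"
      by (rule infinite_level_sets_imp_infinite_integral)
    with f show False
      unfolding L1_G_def by fastforce
  qed
qed

lemma nn_integral_inverse_square_eq_top:
  fixes a b :: real
  assumes "a < b"
  shows "(\<integral>\<^sup>+x\<in>{a<..b}. ennreal (1 / (x - a)\<^sup>2) \<partial>lebesgue) = \<infinity>"
proof (rule ennreal_eq_top_if_unbounded)
  fix n :: nat
  \<comment> \<open>On \<open>{a<..a + d}\<close> the integrand is at least \<open>1 / d\<^sup>2\<close>, so its integral there is at least \<open>1 / d\<close>.\<close>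
  define d where "d = min (b - a) (1 / real (Suc n))"
  have d: "d > 0" "a + d \<le> b" "d \<le> 1 / real (Suc n)"
    using assms by (auto simp: d_def)
  have "real n \<le> 1 / d"
    using d by (simp add: field_simps)
  then have "ennreal (real n) \<le> ennreal (1 / d\<^sup>2 * d)"
    using d by (intro ennreal_leI) (simp add: power2_eq_square)
  also have "\<dots> = ennreal (1 / d\<^sup>2) * emeasure lebesgue {a<..a + d}"
    using d by (simp flip: ennreal_mult)
  also have "\<dots> \<le> (\<integral>\<^sup>+x\<in>{a<..b}. ennreal (1 / (x - a)\<^sup>2) \<partial>lebesgue)"
    using d by (intro level_set_lower_bound)
      (auto intro!: ennreal_leI divide_left_mono power_mono mult_pos_pos)
  finally show "ennreal (real n) \<le> \<dots>" .
qed

lemma ex_L1_H_not_L1_G: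
  assumes I: "I \<in> sets lebesgue" and ab: "a < b" "{a<..b} \<subseteq> I"
  shows "\<exists>f. f \<in> L1_H I \<and> f \<notin> L1_G I"
proof -
  define f where "f = restrict (\<lambda>x. if x \<in> {a<..b} then 1 / (x - a)\<^sup>2 else 0) I"
  have "(\<lambda>x. if x \<in> {a<..b} then 1 / (x - a)\<^sup>2 else 0) \<in> borel_measurable borel"
    by measurable
  then have "(\<lambda>x. if x \<in> {a<..b} then 1 / (x - a)\<^sup>2 else 0) \<in> borel_measurable (lebesgue_on I)"
    by (intro measurable_restrict_space1 measurable_completion) simp
  then have "f \<in> borel_measurable (lebesgue_on I)"
    by (rule measurable_cong[THEN iffD1, rotated]) (auto simp: f_def)
  then have f_meas: "f \<in> lebesgue_measurable_funs I"
    by (simp add: lebesgue_measurable_funs_def f_def)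
  have "{x \<in> I. \<bar>f x\<bar> \<ge> 1} \<subseteq> {a<..b}"
    by (auto simp: f_def split: if_splits)
  then have "emeasure lebesgue {x \<in> I. \<bar>f x\<bar> \<ge> 1} \<le> emeasure lebesgue {a<..b}"
    by (intro emeasure_mono) auto
  also have "\<dots> < \<infinity>"
    using ab by simp
  finally have "f \<in> L1_H I"
    using f_meas by (auto simp: L1_H_def intro!: exI[of _ 1])
  moreover have "(\<integral>\<^sup>+x\<in>{a<..b}. ennreal \<bar>f x\<bar> \<partial>lebesgue) = \<infinity>"
  proof -
    have "(\<integral>\<^sup>+x\<in>{a<..b}. ennreal \<bar>f x\<bar> \<partial>lebesgue) = (\<integral>\<^sup>+x\<in>{a<..b}. ennreal (1 / (x - a)\<^sup>2) \<partial>lebesgue)"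
      using ab by (intro nn_integral_cong) (auto simp: f_def indicator_def)
    then show ?thesis
      using nn_integral_inverse_square_eq_top[OF ab(1)] by simp
  qed
  then have "f \<notin> L1_G I"
    using ab by (auto simp: L1_G_def intro!: exI[of _ "{a<..b}"])
  ultimately show ?thesis by blast
qed

theorem theorem3p0p5:
  fixes I :: "real set"
  assumes "nondegenerate_interval I"
  shows "L1_G I \<subseteq> L1_H I \<and> L1_G I \<noteq> L1_H I"
proof -
  obtain a b where ab: "is_interval I" "a \<in> I" "b \<in> I" "a < b"
    using assms by (auto simp: nondegenerate_interval_def)
  have I: "I \<in> sets lebesgue"
    using ab(1) by (intro sets_completionI_sets) (simp add: is_interval_convex real_interval_borel_measurable)
  have "{a<..b} \<subseteq> I"
    using ab mem_is_interval_1_I[of I a b] by (meson greaterThanAtMost_iff less_imp_le subsetI)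
  then have "\<exists>f. f \<in> L1_H I \<and> f \<notin> L1_G I"
    by (rule ex_L1_H_not_L1_G[OF I ab(4)])
  with L1_G_subset_L1_H[OF I] show ?thesis
    by blast
qed

end
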